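(* Let $m\ge 1$, $n\ge 1$ and $1\le k\le n$ be integers. Let $X_1,\dots,X_m$ be independent real random variables with probability densities $f_{X_1},\dots,f_{X_m}$, and write $f_X=f_{X_1}$. Let $S=\sum_{i=1}^m X_i$ with cumulative distribution function $F_S$, and let $T=\sum_{i=2}^m X_i$. Then the first addend $\tilde X$ of the $k$-th order statistic of a length-$n$ sample of the sum $S$ has density $$f_{\tilde X}(x)=\frac{n!}{(k-1)!\,(n-k)!}\,f_X(x)\,\mathbb{E}_T\left\{F_S(x+T)^{k-1}\bigl(1-F_S(x+T)\bigr)^{n-k}\right\},$$ where $\mathbb{E}_T\{\cdot\}$ denotes expectation with respect to the distribution of $T$.
   Context: A length-$n$ sample of the sum is built as follows: let $(X_{j,1},\dots,X_{j,m})$, $j=1,\dots,n$, be $n$ independent copies of $(X_1,\dots,X_m)$, and put $S_j=\sum_{i=1}^m X_{j,i}$. The $k$-th order statistic $S_{(k,n)}$ is the $k$-th smallest of $S_1,\dots,S_n$ (almost surely there are no ties, since $S$ has a density). Let $J$ be the almost surely unique index with $S_J=S_{(k,n)}$. The first addend of the $k$-th order statistic is the random variable $\tilde X:=X_{J,1}$, i.e. the first addend in the row whose sum is the $k$-th smallest. For $m=1$ the empty sum $T$ is $0$. As usual, identities between densities are understood for almost every $x$. *)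

theory Defs
  imports "HOL-Probability.Probability"
begin

text \<open>The \<open>k\<close>-th smallest (counted from 1, with multiplicity) of \<open>s 1, \<dots>, s n\<close>;
  meaningful for \<open>1 \<le> k \<le> n\<close>.\<close>

definition order_stat :: "nat \<Rightarrow> nat \<Rightarrow> (nat \<Rightarrow> real) \<Rightarrow> real" where
  "order_stat k n s = sort (map s [1..<Suc n]) ! (k - 1)"

lemma sorted_nth_le_iff:
  fixes xs :: "real list"
  assumes "sorted xs" "i < length xs"
  shows "xs ! i \<le> a \<longleftrightarrow> i < length (filter (\<lambda>x. x \<le> a) xs)"
  using assms
proof (induction xs arbitrary: i)
  case (Cons x xs)
  show ?case
  proof (cases "x \<le> a")
    case True
    with Cons show ?thesis by (cases i) auto
  next
    case False
    with Cons.prems have "\<And>y. y \<in> set xs \<Longrightarrow> \<not> y \<le> a" by fastforce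
    then have "filter (\<lambda>x. x \<le> a) xs = []" by (simp add: filter_empty_conv)
    moreover have "\<not> (x # xs) ! i \<le> a"
      using False Cons.prems \<open>\<And>y. y \<in> set xs \<Longrightarrow> \<not> y \<le> a\<close> by (cases i) auto
    ultimately show ?thesis using False by simp
  qed
qed simp

lemma order_stat_le_iff:
  assumes "1 \<le> k" "k \<le> n"
  shows "order_stat k n s \<le> a \<longleftrightarrow> k \<le> (\<Sum>j=1..n. if s j \<le> a then 1 else 0)"
proof -
  have "length (filter (\<lambda>x. x \<le> a) (sort (map s [1..<Suc n])))
      = length (filter (\<lambda>j. s j \<le> a) [1..<Suc n])"
    by (simp add: filter_sort filter_map comp_def del: upt_Suc)
  also have "\<dots> = card ({1..n} \<inter> {j. s j \<le> a})"
    by (subst distinct_card[symmetric])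
       (auto simp del: upt_Suc intro!: arg_cong[where f = card])
  also have "\<dots> = (\<Sum>j=1..n. if s j \<le> a then 1 else 0)"
    by (simp add: sum.If_cases)
  finally show ?thesis
    unfolding order_stat_def using assms
    by (subst sorted_nth_le_iff) (auto simp del: upt_Suc)
qed

lemma measurable_order_stat:
  assumes "1 \<le> k" "k \<le> n" "\<And>j. j \<in> {1..n} \<Longrightarrow> S j \<in> borel_measurable N"
  shows "(\<lambda>\<omega>. order_stat k n (\<lambda>j. S j \<omega>)) \<in> borel_measurable N"
  unfolding borel_measurable_iff_le
proof
  fix a
  have "(\<lambda>\<omega>. if S j \<omega> \<le> a then 1 else (0::nat)) \<in> measurable N (count_space UNIV)"
    if "j \<in> {1..n}" for j
  proof -
    note [measurable] = assms(3)[OF that]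
    show ?thesis by measurable
  qed
  then have [measurable]:
    "(\<lambda>\<omega>. \<Sum>j=1..n. if S j \<omega> \<le> a then 1 else (0::nat)) \<in> measurable N (count_space UNIV)"
    by (rule measurable_sum_nat)
  have "{\<omega> \<in> space N. k \<le> (\<Sum>j=1..n. if S j \<omega> \<le> a then 1 else (0::nat))} \<in> sets N"
    by measurable
  then show "{\<omega> \<in> space N. order_stat k n (\<lambda>j. S j \<omega>) \<le> a} \<in> sets N"
    by (simp only: order_stat_le_iff[OF assms(1,2)])
qed

lemma order_stat_attained:
  assumes "1 \<le> k" "k \<le> n"
  shows "\<exists>j\<in>{1..n}. s j = order_stat k n s"
proof -
  have "order_stat k n s \<in> set (sort (map s [1..<Suc n]))"
    unfolding order_stat_def using assms by (intro nth_mem) (simp del: upt_Suc)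
  then show ?thesis by (auto simp del: upt_Suc)
qed

text \<open>A measurable choice of an index realising the order statistic always exists (e.g. by
  breaking ties in favour of the smallest index).\<close>

lemma order_stat_index_exists:
  assumes "1 \<le> k" "k \<le> n" "\<And>j. j \<in> {1..n} \<Longrightarrow> S j \<in> borel_measurable N"
  shows "\<exists>J \<in> measurable N (count_space {1..n}).
           \<forall>\<omega>. S (J \<omega>) \<omega> = order_stat k n (\<lambda>j. S j \<omega>)"
proof -
  define P where "P = (\<lambda>\<omega> j. j \<in> {1..n} \<and> S j \<omega> = order_stat k n (\<lambda>j. S j \<omega>))"
  define J where "J = (\<lambda>\<omega>. LEAST j. P \<omega> j)"
  have "\<exists>j. P \<omega> j" for \<omega>
    using order_stat_attained[OF assms(1,2), of "\<lambda>j. S j \<omega>"] unfolding P_def by blast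
  then have "P \<omega> (J \<omega>)" for \<omega>
    unfolding J_def by (rule LeastI_ex)
  then have J: "J \<omega> \<in> {1..n}" "S (J \<omega>) \<omega> = order_stat k n (\<lambda>j. S j \<omega>)" for \<omega>
    unfolding P_def by blast+
  have "Measurable.pred N (\<lambda>\<omega>. P \<omega> j)" for j
  proof (cases "j \<in> {1..n}")
    case True
    note [measurable] = assms(3)[OF True] measurable_order_stat[where S = S, OF assms]
    have "Measurable.pred N (\<lambda>\<omega>. S j \<omega> = order_stat k n (\<lambda>j. S j \<omega>))"
      by measurable
    with True show ?thesis unfolding P_def by simp
  next
    case False
    then have "(\<lambda>\<omega>. P \<omega> j) = (\<lambda>\<omega>. False)" unfolding P_def by blast
    then show ?thesis by simp
  qed
  then have "J \<in> measurable N (count_space UNIV)"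
    unfolding J_def by (rule measurable_Least)
  then have "J -` {j} \<inter> space N \<in> sets N" for j
    by (rule measurable_sets) simp
  moreover have "J \<in> space N \<rightarrow> {1..n}"
    using J(1) by blast
  ultimately have "J \<in> measurable N (count_space {1..n})"
    by (subst measurable_count_space_eq2) blast+
  with J(2) show ?thesis by blast
qed

end

theory Submission
  imports Defs
begin

text \<open>The law of \<open>S\<close> has no atoms, so almost surely the row sums are distinct and row \<open>j\<close> is
  selected iff exactly \<open>k - 1\<close> of the other sums are at most \<open>S j\<close>. Conditionally on row \<open>j\<close>, the
  number of such sums is binomial with parameters \<open>n - 1\<close> and \<open>F (S j)\<close>. Summing over \<open>j\<close>, the
  selected row has density \<open>n\<close> times this binomial weight with respect to the law of
  \<open>(X 1, \<dots>, X m)\<close>; the first marginal follows by Fubini, as \<open>X 1\<close> and \<open>T\<close> are independent.\<close>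

section \<open>Ranks of a finite sample without ties\<close>

text \<open>Let \<open>rk a\<close> count the indices whose value is at most \<open>a\<close>. This
  count jumps at every sample value, so it separates sample values, and the order statistic turns
  out to be the sample value of rank exactly \<open>k\<close>. Index \<open>j\<close> contributes
  one to its own rank, which leaves \<open>k - 1\<close> for the others. Injectivity excludes a tie
  at the order statistic, which could push its rank above \<open>k\<close>.\<close>

lemma order_stat_eq_iff_card:
  assumes k: "1 \<le> k" "k \<le> n" and inj: "inj_on s {1..n}" and j: "j \<in> {1..n}"
  shows "s j = order_stat k n s \<longleftrightarrow> card {l \<in> {1..n} - {j}. s l \<le> s j} = k - 1"
proof -
  define rk where "rk a = card {l \<in> {1..n}. s l \<le> a}" for a
  have le_iff: "order_stat k n s \<le> a \<longleftrightarrow> k \<le> rk a" for a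
    using order_stat_le_iff[OF k, of s a] by (simp add: rk_def sum.If_cases Int_def)
  have strict: "rk a < rk (s i)" if "a < s i" "i \<in> {1..n}" for a i
  proof -
    have "i \<in> {l \<in> {1..n}. s l \<le> s i}" "i \<notin> {l \<in> {1..n}. s l \<le> a}" using that by auto
    moreover have "{l \<in> {1..n}. s l \<le> a} \<subseteq> {l \<in> {1..n}. s l \<le> s i}" using that by auto
    ultimately show ?thesis unfolding rk_def
      by (intro psubset_card_mono psubsetI) (simp, blast, metis)
  qed
  have rk: "rk (s i) = Suc (card {l \<in> {1..n} - {i}. s l \<le> s i})" if "i \<in> {1..n}" for i
  proof -
    have "{l \<in> {1..n}. s l \<le> s i} = insert i {l \<in> {1..n} - {i}. s l \<le> s i}" using that by auto
    then show ?thesis unfolding rk_def by (simp add: card_insert_if)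
  qed
  obtain i where i: "i \<in> {1..n}" "s i = order_stat k n s"
    using order_stat_attained[OF k] by blast
  have "rk (s i) = k"
  proof (rule antisym)
    show "k \<le> rk (s i)" using le_iff[of "s i"] i by simp
    show "rk (s i) \<le> k"
    proof (rule ccontr)
      assume "\<not> rk (s i) \<le> k"
      then have kc: "k \<le> card {l \<in> {1..n} - {i}. s l \<le> s i}" using rk[OF i(1)] by simp
      \<comment> \<open>At least \<open>k\<close> other indices lie at or below \<open>s i\<close>,
        hence strictly below by injectivity. The largest of these values, \<open>a\<close>, then
        already has rank at least \<open>k\<close>, so \<open>le_iff\<close> forces the order
        statistic down to \<open>a < s i\<close>.\<close>
      define L where "L = {l \<in> {1..n} - {i}. s l \<le> s i}"
      define a where "a = Max (s ` L)"
      have "finite L" by (simp add: L_def)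
      moreover have "L \<noteq> {}" using kc k unfolding L_def[symmetric] by auto
      ultimately have L: "finite L" "L \<noteq> {}" .
      have "a \<in> s ` L" unfolding a_def using L by (intro Max_in) auto
      then obtain l where l: "l \<in> L" "a = s l" by blast
      then have "s l \<le> s i" "s l \<noteq> s i"
        using inj_on_eq_iff[OF inj, of l i] i(1) by (auto simp: L_def)
      then have "a < s i" using l by simp
      have "s l \<le> a" if "l \<in> L" for l unfolding a_def using L that by (intro Max_ge) auto
      moreover have "L \<subseteq> {1..n}" by (auto simp: L_def)
      ultimately have "L \<subseteq> {l \<in> {1..n}. s l \<le> a}" by blast
      then have "card L \<le> rk a" unfolding rk_def by (intro card_mono) auto
      with kc have "order_stat k n s \<le> a" by (simp add: le_iff L_def)
      with \<open>a < s i\<close> i show False by simp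
    qed
  qed
  moreover have "s j = s i" if "rk (s j) = rk (s i)"
    using strict[of "s j" i] strict[of "s i" j] that i j by (metis linorder_neqE less_irrefl)
  ultimately have "s j = order_stat k n s \<longleftrightarrow> rk (s j) = k" using i by auto
  then show ?thesis using rk[OF j] k by auto
qed

section \<open>Finite product measures: the binomial count and the absence of ties\<close>

text \<open>Split the event by the set \<open>L\<close> of the indices whose value is at most
  \<open>a\<close>. Each \<open>L\<close> of size \<open>r\<close> gives a box whose mass is a
  product over the coordinates and depends on \<open>r\<close> alone, and \<open>L\<close> ranges
  over \<open>card I choose r\<close> sets. For \<open>r > card I\<close> both sides vanish.\<close>

lemma emeasure_PiM_card_le:
  fixes g :: "'c \<Rightarrow> real"
  assumes "prob_space \<mu>" and g [measurable]: "g \<in> borel_measurable \<mu>" and I: "finite I"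
  shows "emeasure (PiM I (\<lambda>_. \<mu>)) {x \<in> space (PiM I (\<lambda>_. \<mu>)). card {l \<in> I. g (x l) \<le> a} = r} =
    ennreal (real (card I choose r) * cdf (distr \<mu> borel g) a ^ r *
      (1 - cdf (distr \<mu> borel g) a) ^ (card I - r))"
proof -
  interpret prob_space \<mu> by fact
  interpret P: product_sigma_finite "\<lambda>_. \<mu>" by unfold_locales
  define F where "F = cdf (distr \<mu> borel g) a"
  define D where "D L = (\<Pi>\<^sub>E l\<in>I. if l \<in> L then {v \<in> space \<mu>. g v \<le> a} else {v \<in> space \<mu>. \<not> g v \<le> a})" for L
  define \<L> where "\<L> = {L. L \<subseteq> I \<and> card L = r}"
  have "0 \<le> F" by (simp add: F_def cdf_def)
  have F: "emeasure \<mu> {v \<in> space \<mu>. g v \<le> a} = ennreal F"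
    unfolding F_def cdf_def emeasure_eq_measure
    by (subst measure_distr) (auto intro!: arg_cong[where f="measure \<mu>"])
  have F': "emeasure \<mu> {v \<in> space \<mu>. \<not> g v \<le> a} = ennreal (1 - F)"
    using F prob_neg[of "\<lambda>v. g v \<le> a"] \<open>0 \<le> F\<close> by (simp add: emeasure_eq_measure)
  have F01: "0 \<le> F" "0 \<le> 1 - F"
    using F prob_le_1[of "{v \<in> space \<mu>. g v \<le> a}"] \<open>0 \<le> F\<close> by (auto simp: emeasure_eq_measure)
  have D: "emeasure (PiM I (\<lambda>_. \<mu>)) (D L) = ennreal (F ^ r * (1 - F) ^ (card I - r))" if "L \<in> \<L>" for L
  proof -
    have L: "L \<subseteq> I" "card L = r" "finite L" using that I finite_subset by (auto simp: \<L>_def)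
    have "emeasure (PiM I (\<lambda>_. \<mu>)) (D L) = (\<Prod>l\<in>I. if l \<in> L then ennreal F else ennreal (1 - F))"
      unfolding D_def by (subst P.emeasure_PiM[OF I]) (auto simp: F F' intro!: prod.cong)
    also have "\<dots> = ennreal F ^ r * ennreal (1 - F) ^ (card I - r)"
      using L I by (simp add: prod.If_cases Int_absorb1 Diff_eq[symmetric] card_Diff_subset)
    finally show ?thesis using F01 by (simp add: ennreal_power ennreal_mult)
  qed
  have "{x \<in> space (PiM I (\<lambda>_. \<mu>)). card {l \<in> I. g (x l) \<le> a} = r} = (\<Union>L\<in>\<L>. D L)"
  proof (intro equalityI subsetI)
    fix x assume x: "x \<in> {x \<in> space (PiM I (\<lambda>_. \<mu>)). card {l \<in> I. g (x l) \<le> a} = r}"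
    then have "x \<in> D {l \<in> I. g (x l) \<le> a}"
      by (auto simp: D_def space_PiM PiE_iff)
    moreover have "{l \<in> I. g (x l) \<le> a} \<in> \<L>" using x by (simp add: \<L>_def)
    ultimately show "x \<in> (\<Union>L\<in>\<L>. D L)" by blast
  next
    fix x assume "x \<in> (\<Union>L\<in>\<L>. D L)"
    then obtain L where L: "L \<in> \<L>" "x \<in> D L" by blast
    then have *: "(g (x l) \<le> a \<longleftrightarrow> l \<in> L) \<and> x l \<in> space \<mu>" if "l \<in> I" for l
      using that by (auto simp: D_def PiE_iff split: if_splits)
    then have "{l \<in> I. g (x l) \<le> a} = L" using L by (auto simp: \<L>_def)
    with L * show "x \<in> {x \<in> space (PiM I (\<lambda>_. \<mu>)). card {l \<in> I. g (x l) \<le> a} = r}"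
      by (auto simp: \<L>_def D_def space_PiM PiE_iff)
  qed
  moreover have "disjoint_family_on D \<L>"
    unfolding disjoint_family_on_def
  proof (intro ballI impI)
    fix L L' assume *: "L \<in> \<L>" "L' \<in> \<L>" "L \<noteq> L'"
    have "{l \<in> I. g (x l) \<le> a} = L" if "x \<in> D L" "L \<in> \<L>" for x L
      using that by (auto simp: D_def PiE_iff \<L>_def split: if_splits)
    with * show "D L \<inter> D L' = {}" by blast
  qed
  moreover have "finite \<L>" using I by (simp add: \<L>_def)
  moreover have "D ` \<L> \<subseteq> sets (PiM I (\<lambda>_. \<mu>))"
    unfolding D_def by (auto intro!: sets_PiM_I_finite I)
  ultimately have "emeasure (PiM I (\<lambda>_. \<mu>)) {x \<in> space (PiM I (\<lambda>_. \<mu>)). card {l \<in> I. g (x l) \<le> a} = r} =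
      (\<Sum>L\<in>\<L>. emeasure (PiM I (\<lambda>_. \<mu>)) (D L))"
    by (simp add: sum_emeasure)
  also have "\<dots> = of_nat (card I choose r) * ennreal (F ^ r * (1 - F) ^ (card I - r))"
    by (simp add: D n_subsets[OF I] \<L>_def)
  finally show ?thesis
    unfolding ennreal_of_nat_eq_real_of_nat F_def[symmetric]
    by (subst (asm) ennreal_mult'[symmetric]) (simp_all only: mult.assoc of_nat_0_le_iff)
qed

text \<open>There are finitely many pairs of indices. For one pair, freeze all coordinates except
  \<open>j\<close>: the tie event becomes a level set of \<open>g\<close> in the free coordinate,
  which is null since \<open>g\<close> has no atoms under \<open>\<mu>\<close>.\<close>

lemma AE_PiM_inj_on:
  fixes g :: "'c \<Rightarrow> real"
  assumes "prob_space \<mu>" and g [measurable]: "g \<in> borel_measurable \<mu>" and I: "finite I"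
    and atomless: "\<And>s. emeasure \<mu> {v \<in> space \<mu>. g v = s} = 0"
  shows "AE x in PiM I (\<lambda>_. \<mu>). inj_on (\<lambda>l. g (x l)) I"
proof -
  interpret prob_space \<mu> by fact
  interpret P: product_sigma_finite "\<lambda>_. \<mu>" by unfold_locales
  have "AE x in PiM I (\<lambda>_. \<mu>). g (x l) \<noteq> g (x j)" if lj: "l \<in> I" "j \<in> I" "l \<noteq> j" for l j
  proof -
    have I': "insert j (I - {j}) = I" using lj by auto
    have [measurable]: "(\<lambda>x. x l) \<in> measurable (PiM I (\<lambda>_. \<mu>)) \<mu>" "(\<lambda>x. x j) \<in> measurable (PiM I (\<lambda>_. \<mu>)) \<mu>"
      using lj by auto
    have m: "{x \<in> space (PiM I (\<lambda>_. \<mu>)). g (x l) = g (x j)} \<in> sets (PiM I (\<lambda>_. \<mu>))" (is "?A \<in> _")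
      by measurable
    have "emeasure (PiM I (\<lambda>_. \<mu>)) ?A = (\<integral>\<^sup>+ x. indicator ?A x \<partial>PiM (insert j (I - {j})) (\<lambda>_. \<mu>))"
      unfolding I' using m by (rule nn_integral_indicator[symmetric])
    also have "\<dots> = (\<integral>\<^sup>+ x. \<integral>\<^sup>+ y. indicator ?A (x(j := y)) \<partial>\<mu> \<partial>PiM (I - {j}) (\<lambda>_. \<mu>))"
      using m I by (intro P.product_nn_integral_insert) (unfold I', auto)
    also have "\<dots> = (\<integral>\<^sup>+ x. emeasure \<mu> {v \<in> space \<mu>. g v = g (x l)} \<partial>PiM (I - {j}) (\<lambda>_. \<mu>))"
    proof (intro nn_integral_cong)
      fix x assume x: "x \<in> space (PiM (I - {j}) (\<lambda>_. \<mu>))"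
      have "(\<integral>\<^sup>+ y. indicator ?A (x(j := y)) \<partial>\<mu>) = (\<integral>\<^sup>+ y. indicator {v \<in> space \<mu>. g v = g (x l)} y \<partial>\<mu>)"
        using x lj by (intro nn_integral_cong)
          (auto simp: indicator_def space_PiM PiE_iff extensional_def)
      then show "(\<integral>\<^sup>+ y. indicator ?A (x(j := y)) \<partial>\<mu>) = emeasure \<mu> {v \<in> space \<mu>. g v = g (x l)}"
        by simp
    qed
    finally have "emeasure (PiM I (\<lambda>_. \<mu>)) ?A = 0" by (simp add: atomless)
    then show ?thesis using m by (intro AE_I[of _ _ ?A]) auto
  qed
  then have "AE x in PiM I (\<lambda>_. \<mu>). \<forall>(l, j)\<in>I \<times> I. l \<noteq> j \<longrightarrow> g (x l) \<noteq> g (x j)"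
    using I by (intro AE_finite_allI) auto
  then show ?thesis by eventually_elim (auto simp: inj_on_def)
qed

section \<open>The law of the selected row\<close>

lemma borel_measurable_cdf:
  assumes "prob_space D" "sets D = sets borel"
  shows "cdf D \<in> borel_measurable borel"
proof -
  interpret prob_space D by fact
  interpret finite_borel_measure D by unfold_locales fact
  show ?thesis by (intro borel_measurable_mono monoI cdf_nondecreasing)
qed

lemma measurable_card_le:
  fixes a :: "nat \<Rightarrow> 'b \<Rightarrow> real"
  assumes "\<And>l. l \<in> L \<Longrightarrow> a l \<in> borel_measurable P" and [measurable]: "b \<in> borel_measurable P"
  shows "(\<lambda>x. card {l \<in> L. a l x \<le> b x}) \<in> measurable P (count_space UNIV)"
proof (rule measurable_card)
  fix l
  show "{x \<in> space P. l \<in> {l \<in> L. a l x \<le> b x}} \<in> sets P"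
  proof (cases "l \<in> L")
    case True
    note [measurable] = assms(1)[OF this]
    show ?thesis using True by simp
  qed simp
qed

text \<open>Rows are abstracted to i.i.d. elements of a space \<open>K\<close>, ranked by a real
  functional \<open>g\<close>; in the theorem \<open>g\<close> is the row sum. The event is split by
  the value of \<open>J\<close>. For each \<open>j\<close>, freezing row \<open>j\<close> leaves
  \<open>n - 1\<close> independent rows, to which the binomial count applies.\<close>

lemma distr_order_stat_index:
  fixes R :: "nat \<Rightarrow> 'b \<Rightarrow> 'c" and g :: "'c \<Rightarrow> real"
  assumes k: "1 \<le> k" "k \<le> n" and N: "prob_space N"
    and indep: "prob_space.indep_vars N (\<lambda>_. K) R {1..n}"
    and law: "\<And>j. j \<in> {1..n} \<Longrightarrow> distr N K (R j) = \<mu>"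
    and g [measurable]: "g \<in> borel_measurable K"
    and atomless: "\<And>s. emeasure \<mu> {v \<in> space \<mu>. g v = s} = 0"
    and J [measurable]: "J \<in> measurable N (count_space {1..n})"
    and sel: "AE \<omega> in N. g (R (J \<omega>) \<omega>) = order_stat k n (\<lambda>j. g (R j \<omega>))"
  shows "(\<lambda>\<omega>. R (J \<omega>) \<omega>) \<in> measurable N K"
    and "distr N K (\<lambda>\<omega>. R (J \<omega>) \<omega>) = density \<mu> (\<lambda>v. ennreal
      (fact n / (fact (k - 1) * fact (n - k)) *
        (cdf (distr \<mu> borel g) (g v) ^ (k - 1) * (1 - cdf (distr \<mu> borel g) (g v)) ^ (n - k))))"
proof -
  interpret N: prob_space N by fact
  let ?I = "{1..n}"
  have R [measurable]: "R j \<in> measurable N K" if "j \<in> ?I" for j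
    using indep that by (auto simp: N.indep_vars_def)
  have J_in: "J \<omega> \<in> ?I" if "\<omega> \<in> space N" for \<omega>
    using measurable_space[OF J that] by simp
  show RJ [measurable]: "(\<lambda>\<omega>. R (J \<omega>) \<omega>) \<in> measurable N K"
    by (rule measurable_compose_countable'[OF _ J]) (auto simp: countable_finite)
  \<comment> \<open>Some row exists, and from it \<open>\<mu>\<close> inherits its sigma-algebra and
    total mass one.\<close>
  have one: "1 \<in> ?I" using k by simp
  have sets_mu [measurable_cong]: "sets \<mu> = sets K" using law[OF one] by auto
  have "prob_space \<mu>" using law[OF one] N.prob_space_distr[OF R[OF one]] by simp
  then interpret prob_space \<mu> .
  interpret P: product_sigma_finite "\<lambda>_::nat. \<mu>" by unfold_locales
  have [measurable]: "g \<in> borel_measurable \<mu>" by measurable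
  define F where "F = cdf (distr \<mu> borel g)"
  have [measurable]: "F \<in> borel_measurable borel"
    unfolding F_def by (intro borel_measurable_cdf prob_space_distr) auto
  \<comment> \<open>The probability that exactly \<open>k - 1\<close> of the other
    \<open>n - 1\<close> rows have \<open>g\<close> at most \<open>a\<close>; the second exponent is
    \<open>(n - 1) - (k - 1)\<close>.\<close>
  define h where "h a = real ((n - 1) choose (k - 1)) * F a ^ (k - 1) * (1 - F a) ^ (n - k)" for a
  have [measurable]: "h \<in> borel_measurable borel" unfolding h_def by measurable
  define P where "P = PiM ?I (\<lambda>_. \<mu>)"
  define V where "V \<omega> = (\<lambda>j\<in>?I. R j \<omega>)" for \<omega>
  have sets_P: "sets P = sets (PiM ?I (\<lambda>_. K))"
    unfolding P_def by (intro sets_PiM_cong refl sets_mu)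
  \<comment> \<open>Independence and equality of the laws make \<open>P\<close> the joint law of all
    rows, so events about the sample can be computed in the product space.\<close>
  have "distr N (PiM ?I (\<lambda>_. K)) V = PiM ?I (\<lambda>j. distr N K (R j))"
    unfolding V_def using N.indep_vars_iff_distr_eq_PiM'[where I = ?I and M' = "\<lambda>_. K" and X = R] indep one R by auto
  also have "\<dots> = P" unfolding P_def by (intro PiM_cong law refl)
  finally have V: "distr N P V = P" using distr_cong[OF refl sets_P] by metis
  have [measurable]: "V \<in> measurable N P"
    unfolding V_def P_def by (intro measurable_restrict) (use R sets_mu in \<open>simp cong: measurable_cong_sets\<close>)
  have [measurable]: "(\<lambda>x. x l) \<in> measurable P \<mu>" if "l \<in> ?I" for l
    using that by (simp add: P_def)
  have "AE x in distr N P V. inj_on (\<lambda>l. g (x l)) ?I"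
    unfolding V unfolding P_def
    by (rule AE_PiM_inj_on) (use \<open>prob_space \<mu>\<close> atomless in auto)
  then have inj: "AE \<omega> in N. inj_on (\<lambda>l. g (V \<omega> l)) ?I"
    by (rule AE_distrD[rotated]) measurable
  \<comment> \<open>The right-hand side does not depend on \<open>j\<close>: all rows contribute
    equally, which later yields the factor \<open>n\<close>.\<close>
  have mJ: "emeasure N {\<omega> \<in> space N. J \<omega> = j \<and> R j \<omega> \<in> B} = (\<integral>\<^sup>+ v. ennreal (h (g v)) * indicator B v \<partial>\<mu>)"
    if j: "j \<in> ?I" and B [measurable]: "B \<in> sets \<mu>" for j B
  proof -
    let ?I' = "?I - {j}"
    have I: "insert j ?I' = ?I" using j by auto
    define E where "E = {x \<in> space P. x j \<in> B \<and> card {l \<in> ?I'. g (x l) \<le> g (x j)} = k - 1}"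
    have [measurable]: "(\<lambda>x. x j) \<in> measurable P \<mu>" using j by simp
    have [measurable]: "(\<lambda>x. card {l \<in> ?I'. g (x l) \<le> g (x j)}) \<in> measurable P (count_space UNIV)"
    proof (rule measurable_card_le)
      fix l assume "l \<in> ?I'"
      then have [measurable]: "(\<lambda>x. x l) \<in> measurable P \<mu>" by simp
      show "(\<lambda>x. g (x l)) \<in> borel_measurable P" by measurable
    qed measurable
    have E [measurable]: "E \<in> sets P" unfolding E_def by measurable
    have [measurable]: "R j \<in> measurable N K" "B \<in> sets K" using j B sets_mu by auto
    have V_in: "V \<omega> \<in> space P" if "\<omega> \<in> space N" for \<omega>
      using that by (rule measurable_space[rotated]) measurable
    have "emeasure N {\<omega> \<in> space N. J \<omega> = j \<and> R j \<omega> \<in> B} = emeasure N (V -` E \<inter> space N)"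
    proof (rule emeasure_eq_AE)
      show "AE \<omega> in N. \<omega> \<in> {\<omega> \<in> space N. J \<omega> = j \<and> R j \<omega> \<in> B} \<longleftrightarrow> \<omega> \<in> V -` E \<inter> space N"
        using inj sel AE_space
      proof eventually_elim
        case (elim \<omega>)
        let ?s = "\<lambda>l. g (R l \<omega>)"
        have inj_s: "inj_on ?s ?I"
          using elim(1) by (rule inj_on_cong[THEN iffD1, rotated]) (simp add: V_def)
        \<comment> \<open>Without ties, equal values of \<open>g\<close> mean equal indices. This
          turns the almost sure property of \<open>J\<close> into a condition on the rank of row
          \<open>j\<close>.\<close>
        have "J \<omega> = j \<longleftrightarrow> ?s (J \<omega>) = ?s j"
          using inj_on_eq_iff[OF inj_s J_in[OF elim(3)] j] by simp
        also have "\<dots> \<longleftrightarrow> ?s j = order_stat k n ?s" unfolding elim(2) by (rule eq_commute)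
        also have "\<dots> \<longleftrightarrow> card {l \<in> ?I'. ?s l \<le> ?s j} = k - 1"
          by (rule order_stat_eq_iff_card[OF k inj_s j])
        also have "{l \<in> ?I'. ?s l \<le> ?s j} = {l \<in> ?I'. g (V \<omega> l) \<le> g (V \<omega> j)}"
          using j by (auto simp: V_def)
        finally show ?case
          using V_in[OF elim(3)] elim(3) j by (auto simp: E_def V_def)
      qed
      show "V -` E \<inter> space N \<in> sets N" by (rule measurable_sets[OF _ E]) measurable
    qed measurable
    also have "\<dots> = emeasure P E" by (subst V[symmetric]) (simp add: emeasure_distr)
    also have "\<dots> = (\<integral>\<^sup>+ x. indicator E x \<partial>PiM (insert j ?I') (\<lambda>_. \<mu>))"
      unfolding I P_def[symmetric] using E by (rule nn_integral_indicator[symmetric])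
    \<comment> \<open>Row \<open>j\<close> goes into the outer integral, so that inside it is a
      constant \<open>v\<close> and the threshold \<open>g v\<close> is fixed while the other rows
      vary.\<close>
    also have "\<dots> = (\<integral>\<^sup>+ v. \<integral>\<^sup>+ x. indicator E (x(j := v)) \<partial>PiM ?I' (\<lambda>_. \<mu>) \<partial>\<mu>)"
      by (rule P.product_nn_integral_insert_rev) (unfold I P_def[symmetric], auto)
    also have "\<dots> = (\<integral>\<^sup>+ v. ennreal (h (g v)) * indicator B v \<partial>\<mu>)"
    proof (intro nn_integral_cong)
      fix v assume v: "v \<in> space \<mu>"
      define C where "C = {x \<in> space (PiM ?I' (\<lambda>_. \<mu>)). card {l \<in> ?I'. g (x l) \<le> g v} = k - 1}"
      have [measurable]: "(\<lambda>x. card {l \<in> ?I'. g (x l) \<le> g v}) \<in>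
          measurable (PiM ?I' (\<lambda>_. \<mu>)) (count_space UNIV)"
        by (rule measurable_card_le) auto
      have "C \<in> sets (PiM ?I' (\<lambda>_. \<mu>))"
        unfolding C_def by measurable
      have "(\<integral>\<^sup>+ x. indicator E (x(j := v)) \<partial>PiM ?I' (\<lambda>_. \<mu>)) =
          (\<integral>\<^sup>+ x. indicator B v * indicator C x \<partial>PiM ?I' (\<lambda>_. \<mu>))"
      proof (intro nn_integral_cong)
        fix x assume x: "x \<in> space (PiM ?I' (\<lambda>_. \<mu>))"
        have "x(j := v) \<in> space P"
          using x v j by (auto simp: P_def space_PiM PiE_iff extensional_def)
        moreover have "{l \<in> ?I'. g ((x(j := v)) l) \<le> g ((x(j := v)) j)} = {l \<in> ?I'. g (x l) \<le> g v}"
          by auto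
        ultimately show "indicator E (x(j := v)) = (indicator B v * indicator C x :: ennreal)"
          using x by (simp add: E_def C_def indicator_def)
      qed
      also have "\<dots> = indicator B v * emeasure (PiM ?I' (\<lambda>_. \<mu>)) C"
        using \<open>C \<in> _\<close> by (simp add: nn_integral_cmult)
      also have "emeasure (PiM ?I' (\<lambda>_. \<mu>)) C = ennreal (h (g v))"
        using emeasure_PiM_card_le[OF \<open>prob_space \<mu>\<close>, of g ?I' "g v" "k - 1"] j k
        by (simp add: C_def h_def F_def)
      finally show "(\<integral>\<^sup>+ x. indicator E (x(j := v)) \<partial>PiM ?I' (\<lambda>_. \<mu>)) = ennreal (h (g v)) * indicator B v"
        by (simp only: mult.commute)
    qed
    finally show ?thesis .
  qed
  \<comment> \<open>The \<open>n\<close> equal contributions combine with the binomial coefficient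
    into the factorial constant of the density.\<close>
  have coeff: "real n * h a = fact n / (fact (k - 1) * fact (n - k)) * (F a ^ (k - 1) * (1 - F a) ^ (n - k))" for a
  proof -
    have "real n * real ((n - 1) choose (k - 1)) = fact n / (fact (k - 1) * fact (n - k))"
    proof -
      have "real ((n - 1) choose (k - 1)) = fact (n - 1) / (fact (k - 1) * fact (n - 1 - (k - 1)))"
        using k by (intro binomial_fact) simp
      moreover have "fact n = real n * fact (n - 1)" using k by (intro fact_reduce) simp
      moreover have "n - 1 - (k - 1) = n - k" using k by simp
      ultimately show ?thesis by simp
    qed
    then show ?thesis unfolding h_def by (simp only: mult.assoc[symmetric])
  qed
  show "distr N K (\<lambda>\<omega>. R (J \<omega>) \<omega>) = density \<mu> (\<lambda>v. ennreal
      (fact n / (fact (k - 1) * fact (n - k)) *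
        (cdf (distr \<mu> borel g) (g v) ^ (k - 1) * (1 - cdf (distr \<mu> borel g) (g v)) ^ (n - k))))"
    unfolding F_def[symmetric] coeff[symmetric]
  proof (rule measure_eqI)
    fix B assume "B \<in> sets (distr N K (\<lambda>\<omega>. R (J \<omega>) \<omega>))"
    then have B [measurable]: "B \<in> sets K" "B \<in> sets \<mu>" by (auto simp: sets_mu)
    have "emeasure (distr N K (\<lambda>\<omega>. R (J \<omega>) \<omega>)) B = emeasure N (\<Union>j\<in>?I. {\<omega> \<in> space N. J \<omega> = j \<and> R j \<omega> \<in> B})"
      using J_in by (subst emeasure_distr) (auto intro!: arg_cong[where f = "emeasure N"])
    also have "\<dots> = (\<Sum>j\<in>?I. emeasure N {\<omega> \<in> space N. J \<omega> = j \<and> R j \<omega> \<in> B})"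
    proof (rule sum_emeasure[symmetric])
      show "(\<lambda>j. {\<omega> \<in> space N. J \<omega> = j \<and> R j \<omega> \<in> B}) ` ?I \<subseteq> sets N"
      proof safe
        fix j assume "j \<in> ?I"
        then have [measurable]: "R j \<in> measurable N K" by simp
        show "{\<omega> \<in> space N. J \<omega> = j \<and> R j \<omega> \<in> B} \<in> sets N" by measurable
      qed
    qed (auto simp: disjoint_family_on_def)
    also have "\<dots> = of_nat n * (\<integral>\<^sup>+ v. ennreal (h (g v)) * indicator B v \<partial>\<mu>)"
      by (simp add: mJ B)
    also have "\<dots> = (\<integral>\<^sup>+ v. ennreal (real n * h (g v)) * indicator B v \<partial>\<mu>)"
    proof -
      have "ennreal (real n * a) = of_nat n * ennreal a" for a
        unfolding ennreal_of_nat_eq_real_of_nat by (rule ennreal_mult') simp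
      then show ?thesis by (simp add: mult.assoc nn_integral_cmult)
    qed
    finally show "emeasure (distr N K (\<lambda>\<omega>. R (J \<omega>) \<omega>)) B =
        emeasure (density \<mu> (\<lambda>v. ennreal (real n * h (g v)))) B"
      by (simp add: emeasure_density)
  qed (simp add: sets_mu)
qed

section \<open>Independent addends, one of which has a density\<close>

text \<open>By independence the joint law is a product, and Tonelli applies in either order. The
  order with \<open>x\<close> outside produces a marginal density; the order with \<open>t\<close>
  outside serves to show that \<open>U + T\<close> has no atoms.\<close>

lemma (in prob_space) indep_var_nn_integral_density:
  fixes U T :: "'a \<Rightarrow> real"
  assumes indep: "indep_var borel U borel T" and U: "distributed M lborel U d"
    and \<phi> [measurable]: "\<phi> \<in> borel_measurable (borel \<Otimes>\<^sub>M borel)"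
  shows "(\<integral>\<^sup>+ \<omega>. \<phi> (U \<omega>, T \<omega>) \<partial>M) = (\<integral>\<^sup>+ x. d x * (\<integral>\<^sup>+ t. \<phi> (x, t) \<partial>distr M borel T) \<partial>lborel)"
    and "(\<integral>\<^sup>+ \<omega>. \<phi> (U \<omega>, T \<omega>) \<partial>M) = (\<integral>\<^sup>+ t. (\<integral>\<^sup>+ x. d x * \<phi> (x, t) \<partial>lborel) \<partial>distr M borel T)"
proof -
  have [measurable]: "random_variable borel U" "random_variable borel T"
    using indep by (auto dest: indep_var_rv1 indep_var_rv2)
  have [measurable]: "d \<in> borel_measurable borel"
    using distributed_borel_measurable[OF U] by simp
  interpret U: prob_space "distr M borel U" by (rule prob_space_distr) measurable
  interpret T: prob_space "distr M borel T" by (rule prob_space_distr) measurable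
  interpret UT: pair_sigma_finite "distr M borel U" "distr M borel T" by unfold_locales
  \<comment> \<open>\<open>distributed\<close> pushes forward to \<open>lborel\<close>; since
    \<open>borel\<close> has the same sigma-algebra, the resulting measure is the same.\<close>
  have law_U: "distr M borel U = density lborel d"
    using distributed_distr_eq_density[OF U] distr_cong[OF refl sets_lborel[symmetric]] by metis
  have [measurable]: "\<phi> \<in> borel_measurable (distr M borel U \<Otimes>\<^sub>M distr M borel T)"
    by (simp cong: measurable_cong_sets)
  have "(\<integral>\<^sup>+ \<omega>. \<phi> (U \<omega>, T \<omega>) \<partial>M) = (\<integral>\<^sup>+ z. \<phi> z \<partial>distr M (borel \<Otimes>\<^sub>M borel) (\<lambda>\<omega>. (U \<omega>, T \<omega>)))"
    by (simp add: nn_integral_distr)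
  also have "\<dots> = (\<integral>\<^sup>+ z. \<phi> z \<partial>(distr M borel U \<Otimes>\<^sub>M distr M borel T))"
    using indep by (simp add: indep_var_distribution_eq)
  finally have *: "(\<integral>\<^sup>+ \<omega>. \<phi> (U \<omega>, T \<omega>) \<partial>M) = (\<integral>\<^sup>+ z. \<phi> z \<partial>(distr M borel U \<Otimes>\<^sub>M distr M borel T))" .
  have "(\<integral>\<^sup>+ \<omega>. \<phi> (U \<omega>, T \<omega>) \<partial>M) = (\<integral>\<^sup>+ x. \<integral>\<^sup>+ t. \<phi> (x, t) \<partial>distr M borel T \<partial>distr M borel U)"
    unfolding * by (rule T.nn_integral_fst[symmetric]) measurable
  then show "(\<integral>\<^sup>+ \<omega>. \<phi> (U \<omega>, T \<omega>) \<partial>M) = (\<integral>\<^sup>+ x. d x * (\<integral>\<^sup>+ t. \<phi> (x, t) \<partial>distr M borel T) \<partial>lborel)"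
    unfolding law_U by (subst (asm) nn_integral_density) auto
  have "(\<integral>\<^sup>+ \<omega>. \<phi> (U \<omega>, T \<omega>) \<partial>M) = (\<integral>\<^sup>+ t. \<integral>\<^sup>+ x. \<phi> (x, t) \<partial>distr M borel U \<partial>distr M borel T)"
    unfolding * by (rule UT.nn_integral_snd[symmetric]) (simp add: split_def)
  then show "(\<integral>\<^sup>+ \<omega>. \<phi> (U \<omega>, T \<omega>) \<partial>M) = (\<integral>\<^sup>+ t. (\<integral>\<^sup>+ x. d x * \<phi> (x, t) \<partial>lborel) \<partial>distr M borel T)"
    unfolding law_U by (subst (asm) nn_integral_density) auto
qed

text \<open>For fixed \<open>t\<close>, the equation \<open>x + t = s\<close> leaves the single
  point \<open>s - t\<close>, which is Lebesgue null. A density of one addend suffices, so the case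
  where \<open>T\<close> is constantly zero is covered.\<close>

lemma (in prob_space) emeasure_indep_add_eq_0:
  fixes U T :: "'a \<Rightarrow> real"
  assumes indep: "indep_var borel U borel T" and U: "distributed M lborel U d"
  shows "emeasure M {\<omega> \<in> space M. U \<omega> + T \<omega> = s} = 0"
proof -
  have [measurable]: "random_variable borel U" "random_variable borel T"
    using indep by (auto dest: indep_var_rv1 indep_var_rv2)
  have "emeasure M {\<omega> \<in> space M. U \<omega> + T \<omega> = s} = (\<integral>\<^sup>+ \<omega>. indicator {\<omega> \<in> space M. U \<omega> + T \<omega> = s} \<omega> \<partial>M)"
    by (rule nn_integral_indicator[symmetric]) measurable
  also have "\<dots> = (\<integral>\<^sup>+ \<omega>. (\<lambda>z. indicator {s} (fst z + snd z)) (U \<omega>, T \<omega>) \<partial>M)"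
    by (intro nn_integral_cong) (simp add: indicator_def)
  also have "\<dots> = (\<integral>\<^sup>+ t. \<integral>\<^sup>+ x. d x * indicator {s} (x + t) \<partial>lborel \<partial>distr M borel T)"
    by (subst indep_var_nn_integral_density(2)[OF indep U]) auto
  also have "\<dots> = (\<integral>\<^sup>+ t. 0 \<partial>distr M borel T)"
  proof (intro nn_integral_cong)
    fix t
    have "AE x in lborel. x \<noteq> s - t" by (rule AE_lborel_singleton)
    then have "AE x in lborel. d x * indicator {s} (x + t) = 0"
      by eventually_elim (auto simp: indicator_def)
    then show "(\<integral>\<^sup>+ x. d x * indicator {s} (x + t) \<partial>lborel) = 0"
      using nn_integral_cong_AE by fastforce
  qed
  finally show ?thesis by simp
qed

section \<open>The density of the first addend\<close>

theorem proposition1: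
  fixes M :: "'a measure" and N :: "'b measure"
    and X :: "nat \<Rightarrow> 'a \<Rightarrow> real" and f :: "nat \<Rightarrow> real \<Rightarrow> real"
    and Y :: "nat \<Rightarrow> nat \<Rightarrow> 'b \<Rightarrow> real" and J :: "'b \<Rightarrow> nat"
    and m n k :: nat
  assumes "1 \<le> m" and "1 \<le> n" and "1 \<le> k" and "k \<le> n"
    and "prob_space M"
    and "prob_space.indep_vars M (\<lambda>_. borel) X {1..m}"
    and "\<And>i x. i \<in> {1..m} \<Longrightarrow> 0 \<le> f i x"
    and "\<And>i. i \<in> {1..m} \<Longrightarrow> distributed M lborel (X i) (\<lambda>x. ennreal (f i x))"
    and "prob_space N"
    and "prob_space.indep_vars N (\<lambda>_. PiM {1..m} (\<lambda>_. borel))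
           (\<lambda>j \<omega>. \<lambda>i\<in>{1..m}. Y j i \<omega>) {1..n}"
    and "\<And>j. j \<in> {1..n} \<Longrightarrow>
           distr N (PiM {1..m} (\<lambda>_. borel)) (\<lambda>\<omega>. \<lambda>i\<in>{1..m}. Y j i \<omega>) =
           distr M (PiM {1..m} (\<lambda>_. borel)) (\<lambda>\<omega>. \<lambda>i\<in>{1..m}. X i \<omega>)"
    and "J \<in> measurable N (count_space {1..n})"
    and "AE \<omega> in N. (\<Sum>i=1..m. Y (J \<omega>) i \<omega>) = order_stat k n (\<lambda>j. \<Sum>i=1..m. Y j i \<omega>)"
  shows "distributed N lborel (\<lambda>\<omega>. Y (J \<omega>) 1 \<omega>)
    (\<lambda>x. ennreal (fact n / (fact (k - 1) * fact (n - k)) * f 1 x *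
      (LINT t|distr M borel (\<lambda>\<omega>. \<Sum>i=2..m. X i \<omega>).
         cdf (distr M borel (\<lambda>\<omega>. \<Sum>i=1..m. X i \<omega>)) (x + t) ^ (k - 1) *
         (1 - cdf (distr M borel (\<lambda>\<omega>. \<Sum>i=1..m. X i \<omega>)) (x + t)) ^ (n - k))))"
proof -
  interpret M: prob_space M by fact
  interpret N: prob_space N by fact
  note X_dist = assms(8)
  let ?I = "{1..m}"
  have m1: "1 \<in> ?I" using assms(1) by simp
  have ins: "?I = insert 1 {2..m}" using assms(1) by auto
  have [measurable]: "X i \<in> borel_measurable M" if "i \<in> ?I" for i
    using distributed_measurable[OF X_dist[OF that]] by simp
  have X1 [measurable]: "X 1 \<in> borel_measurable M" using m1 by simp
  \<comment> \<open>For \<open>m = 1\<close> this sum is empty and \<open>T\<close> is zero, so the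
    decomposition \<open>S\<close> below holds in that case too.\<close>
  define T where "T \<omega> = (\<Sum>i=2..m. X i \<omega>)" for \<omega>
  have T [measurable]: "T \<in> borel_measurable M"
    unfolding T_def by (rule borel_measurable_sum) auto
  have S: "(\<Sum>i=1..m. X i \<omega>) = X 1 \<omega> + T \<omega>" for \<omega>
    unfolding ins T_def by simp
  have indep: "M.indep_var borel (X 1) borel T"
    unfolding T_def by (rule M.indep_vars_sum) (use assms(6) ins in auto)
  define K where "K = PiM ?I (\<lambda>_. borel :: real measure)"
  define R where "R j \<omega> = (\<lambda>i\<in>?I. Y j i \<omega>)" for j \<omega>
  define V where "V \<omega> = (\<lambda>i\<in>?I. X i \<omega>)" for \<omega>
  define g where "g v = (\<Sum>i=1..m. v i)" for v :: "nat \<Rightarrow> real"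
  have [measurable]: "V \<in> measurable M K"
    unfolding V_def K_def by (intro measurable_restrict) auto
  have [measurable]: "(\<lambda>v. v i) \<in> borel_measurable K" if "i \<in> ?I" for i
    unfolding K_def by (rule measurable_component_singleton[OF that])
  have K1 [measurable]: "(\<lambda>v. v 1) \<in> borel_measurable K" using m1 by simp
  have [measurable]: "g \<in> borel_measurable K"
    unfolding g_def by (rule borel_measurable_sum) auto
  have g_V: "g (V \<omega>) = X 1 \<omega> + T \<omega>" for \<omega>
    unfolding S[symmetric] g_def V_def by (intro sum.cong) auto
  have V_1: "V \<omega> 1 = X 1 \<omega>" for \<omega> using m1 by (simp add: V_def)
  have g_R: "g (R j \<omega>) = (\<Sum>i=1..m. Y j i \<omega>)" for j \<omega>
    unfolding g_def R_def by (intro sum.cong) auto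
  have R_1: "R j \<omega> 1 = Y j 1 \<omega>" for j \<omega> using m1 by (simp add: R_def)
  define F where "F = cdf (distr M borel (\<lambda>\<omega>. \<Sum>i=1..m. X i \<omega>))"
  define c :: real where "c = fact n / (fact (k - 1) * fact (n - k))"
  define G where "G a = F a ^ (k - 1) * (1 - F a) ^ (n - k)" for a
  have S_meas: "(\<lambda>\<omega>. \<Sum>i=1..m. X i \<omega>) \<in> borel_measurable M" unfolding S by measurable
  \<comment> \<open>Identifies the cdf of \<open>g\<close> under the row law, which occurs in the
    density of the selected row, with the cdf of the sum.\<close>
  have law_g: "distr (distr M K V) borel g = distr M borel (\<lambda>\<omega>. \<Sum>i=1..m. X i \<omega>)"
    unfolding S by (subst distr_distr) (auto simp: comp_def g_V)
  interpret S: prob_space "distr M borel (\<lambda>\<omega>. \<Sum>i=1..m. X i \<omega>)"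
    by (rule M.prob_space_distr[OF S_meas])
  have [measurable]: "F \<in> borel_measurable borel"
    unfolding F_def by (rule borel_measurable_cdf[OF S.prob_space_axioms]) simp
  have F01: "0 \<le> F a" "F a \<le> 1" for a
    unfolding F_def cdf_def by (rule measure_nonneg, rule S.prob_le_1)
  have [measurable]: "G \<in> borel_measurable borel" unfolding G_def by measurable
  have G01: "0 \<le> G a" "G a \<le> 1" for a
    using F01[of a] by (auto simp: G_def intro!: mult_le_one power_le_one)
  have c: "0 \<le> c" by (simp add: c_def)
  have atomless: "emeasure (distr M K V) {v \<in> space (distr M K V). g v = s} = 0" for s
  proof -
    have "emeasure (distr M K V) {v \<in> space (distr M K V). g v = s} = emeasure M {\<omega> \<in> space M. X 1 \<omega> + T \<omega> = s}"
      unfolding g_V[symmetric] using measurable_space[of V M K]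
      by (subst emeasure_distr) (auto intro!: arg_cong[where f = "emeasure M"])
    also have "\<dots> = 0"
      by (rule M.emeasure_indep_add_eq_0[OF indep X_dist[OF m1]])
    finally show ?thesis .
  qed
  have RJ: "(\<lambda>\<omega>. R (J \<omega>) \<omega>) \<in> measurable N K"
    "distr N K (\<lambda>\<omega>. R (J \<omega>) \<omega>) = density (distr M K V) (\<lambda>v. ennreal (c * G (g v)))"
  proof -
    have 1: "N.indep_vars (\<lambda>_. K) R {1..n}"
      using assms(10) by (simp add: K_def R_def[abs_def])
    have 2: "distr N K (R j) = distr M K V" if "j \<in> {1..n}" for j
      using assms(11)[OF that] by (simp add: K_def R_def[abs_def] V_def[abs_def])
    have 3: "AE \<omega> in N. g (R (J \<omega>) \<omega>) = order_stat k n (\<lambda>j. g (R j \<omega>))"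
      using assms(13) by (simp add: g_R)
    have 4: "g \<in> borel_measurable K" by measurable
    show "(\<lambda>\<omega>. R (J \<omega>) \<omega>) \<in> measurable N K"
      by (rule distr_order_stat_index(1); rule assms(3,4,9,12) 1 2 3 4 atomless)
    show "distr N K (\<lambda>\<omega>. R (J \<omega>) \<omega>) = density (distr M K V) (\<lambda>v. ennreal (c * G (g v)))"
      unfolding c_def G_def F_def law_g[symmetric]
      by (rule distr_order_stat_index(2); rule assms(3,4,9,12) 1 2 3 4 atomless)
  qed
  note [measurable] = RJ(1)
  have YJ [measurable]: "(\<lambda>\<omega>. Y (J \<omega>) 1 \<omega>) \<in> borel_measurable N"
    using measurable_compose[OF RJ(1) K1] unfolding R_1 .
  interpret T: prob_space "distr M borel T" by (rule M.prob_space_distr[OF T])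
  have [measurable]: "f 1 \<in> borel_measurable borel"
    using distributed_real_measurable[OF assms(7)[OF m1] X_dist[OF m1]] by simp
  \<comment> \<open>The theorem states the expectation as a Bochner integral inside
    \<open>ennreal\<close>, while Tonelli yields a nonnegative integral. They agree because
    \<open>G\<close> takes values in [0, 1] and is therefore integrable against a probability
    measure; nonnegativity of \<open>f 1 x\<close> lets the factor be split off.\<close>
  have dens: "ennreal (c * f 1 x * (LINT t|distr M borel T. G (x + t))) =
      ennreal (f 1 x) * (\<integral>\<^sup>+ t. ennreal (c * G (x + t)) \<partial>distr M borel T)" for x
  proof -
    have "integrable (distr M borel T) (\<lambda>t. G (x + t))"
      using G01 by (intro T.integrable_const_bound[where B = 1]) auto
    then have "(\<integral>\<^sup>+ t. ennreal (c * G (x + t)) \<partial>distr M borel T) = ennreal (c * (LINT t|distr M borel T. G (x + t)))"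
      using G01 c by (subst nn_integral_eq_integral) auto
    then show ?thesis
      using assms(7)[OF m1, of x] by (simp add: ennreal_mult'[symmetric] ac_simps)
  qed
  have dens_meas: "(\<lambda>x. ennreal (c * f 1 x * (LINT t|distr M borel T. G (x + t)))) \<in> borel_measurable lborel"
    unfolding dens
  proof (intro borel_measurable_times_ennreal)
    show "(\<lambda>x. ennreal (f 1 x)) \<in> borel_measurable lborel"
      by (rule distributed_borel_measurable[OF X_dist[OF m1]])
    show "(\<lambda>x. \<integral>\<^sup>+ t. ennreal (c * G (x + t)) \<partial>distr M borel T) \<in> borel_measurable lborel"
      by (rule T.borel_measurable_nn_integral) measurable
  qed
  have "distributed N lborel (\<lambda>\<omega>. Y (J \<omega>) 1 \<omega>)
      (\<lambda>x. ennreal (c * f 1 x * (LINT t|distr M borel T. G (x + t))))"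
    unfolding distributed_def
  proof (intro conjI dens_meas)
    show "distr N lborel (\<lambda>\<omega>. Y (J \<omega>) 1 \<omega>) = density lborel
        (\<lambda>x. ennreal (c * f 1 x * (LINT t|distr M borel T. G (x + t))))"
    proof (rule measure_eqI)
      fix A assume "A \<in> sets (distr N lborel (\<lambda>\<omega>. Y (J \<omega>) 1 \<omega>))"
      then have A [measurable]: "A \<in> sets borel" by simp
      have "emeasure (distr N lborel (\<lambda>\<omega>. Y (J \<omega>) 1 \<omega>)) A = emeasure N ((\<lambda>\<omega>. Y (J \<omega>) 1 \<omega>) -` A \<inter> space N)"
        using YJ A by (intro emeasure_distr) simp_all
      \<comment> \<open>The first addend is a coordinate of the selected row, so its event is a
        cylinder for the law already computed.\<close>
      also have "\<dots> = emeasure (distr N K (\<lambda>\<omega>. R (J \<omega>) \<omega>)) ((\<lambda>v. v 1) -` A \<inter> space K)"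
        using measurable_space[OF RJ(1)] measurable_sets[OF K1 A]
        by (subst emeasure_distr) (auto simp: R_1 simp del: One_nat_def intro!: arg_cong[where f = "emeasure N"])
      also have "\<dots> = (\<integral>\<^sup>+ v. ennreal (c * G (g v)) * indicator ((\<lambda>v. v 1) -` A \<inter> space K) v \<partial>distr M K V)"
        unfolding RJ(2) using measurable_sets[OF K1 A] by (subst emeasure_density) auto
      also have "\<dots> = (\<integral>\<^sup>+ v. ennreal (c * G (g v)) * indicator A (v 1) \<partial>distr M K V)"
        by (intro nn_integral_cong) (auto simp: indicator_def)
      \<comment> \<open>The row enters only through its sum and its first entry, hence through the
        independent pair \<open>X 1\<close>, \<open>T\<close>.\<close>
      also have "\<dots> = (\<integral>\<^sup>+ \<omega>. (\<lambda>z. ennreal (c * G (fst z + snd z)) * indicator A (fst z)) (X 1 \<omega>, T \<omega>) \<partial>M)"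
        by (subst nn_integral_distr) (auto simp: g_V V_1 simp del: One_nat_def)
      also have "\<dots> = (\<integral>\<^sup>+ x. ennreal (f 1 x) *
          (\<integral>\<^sup>+ t. ennreal (c * G (x + t)) * indicator A x \<partial>distr M borel T) \<partial>lborel)"
        by (subst M.indep_var_nn_integral_density(1)[OF indep X_dist[OF m1]]) auto
      \<comment> \<open>The indicator depends on \<open>x\<close> alone and leaves the integral over
        \<open>t\<close>, which then is the one in \<open>dens\<close>.\<close>
      also have "\<dots> = (\<integral>\<^sup>+ x. ennreal (f 1 x) *
          (\<integral>\<^sup>+ t. ennreal (c * G (x + t)) \<partial>distr M borel T) * indicator A x \<partial>lborel)"
        by (intro nn_integral_cong) (auto simp: indicator_def)
      also have "\<dots> = emeasure (density lborel
          (\<lambda>x. ennreal (c * f 1 x * (LINT t|distr M borel T. G (x + t))))) A"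
        unfolding dens[symmetric] by (rule emeasure_density[OF dens_meas, symmetric]) simp
      finally show "emeasure (distr N lborel (\<lambda>\<omega>. Y (J \<omega>) 1 \<omega>)) A = \<dots>" .
    qed simp
  qed (use YJ in simp)
  then show ?thesis
    unfolding c_def G_def F_def T_def[abs_def] .
qed

end
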